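(* If $P$ is a default-enabled meet-semilattice, and for all $a,b\in P$ the set $\{x\in P: x\wedge a\le b\}$ is default-enabled within $P$, then the complete lattice $\mathrm{Nuc}(P)$ of all nuclei on $P$ is a frame.
   Context: A meet-semilattice is a poset in which any two elements have a meet. A poset has a ceiling if each of its elements is below some maximal element of it (the empty poset has a ceiling); a subset of a poset has a ceiling if it does so as a subposet. A poset $P$ is default-enabled if for every subset $X\subseteq P$ (including $X=\emptyset$) the set of all lower bounds of $X$ in $P$ has a ceiling. A subset $A$ of a poset $P$ is default-enabled within $P$ if (i) the subposet $A$ is default-enabled, and (ii) for every $x\in P$ the set $\{y\in A: y\le x\}$ has a ceiling. A nucleus on $P$ is a map $P\to P$ that is increasing, ascending ($x\le\gamma(x)$), idempotent and preserves binary meets. $\mathrm{Nuc}(P)$ is ordered pointwise; under the stated hypotheses it is a complete lattice. A frame is a complete lattice in which $x\wedge\bigvee Y=\bigvee_{y\in Y}(x\wedge y)$ for every element $x$ and every subset $Y$. *)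

theory Defs
  imports "HOL-Algebra.Complete_Lattice"
begin

text \<open>
  Posets are records as in HOL-Algebra, possibly with empty carrier; the subposet of \<open>P\<close> on a
  subset \<open>A\<close> of its carrier is \<open>P\<lparr>carrier := A\<rparr>\<close>.
\<close>

definition maximal :: "('a, 'm) gorder_scheme \<Rightarrow> 'a \<Rightarrow> bool" where
  "maximal P m \<longleftrightarrow> m \<in> carrier P \<and> (\<forall>x\<in>carrier P. m \<sqsubseteq>\<^bsub>P\<^esub> x \<longrightarrow> x = m)"

definition has_ceiling :: "('a, 'm) gorder_scheme \<Rightarrow> bool" where
  "has_ceiling P \<longleftrightarrow> (\<forall>x\<in>carrier P. \<exists>m. maximal P m \<and> x \<sqsubseteq>\<^bsub>P\<^esub> m)"

definition default_enabled :: "('a, 'm) gorder_scheme \<Rightarrow> bool" where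
  "default_enabled P \<longleftrightarrow> (\<forall>X\<subseteq>carrier P. has_ceiling (P\<lparr>carrier := Lower P X\<rparr>))"

definition default_enabled_within :: "('a, 'm) gorder_scheme \<Rightarrow> 'a set \<Rightarrow> bool" where
  "default_enabled_within P A \<longleftrightarrow>
     A \<subseteq> carrier P \<and>
     default_enabled (P\<lparr>carrier := A\<rparr>) \<and>
     (\<forall>x\<in>carrier P. has_ceiling (P\<lparr>carrier := {y \<in> A. y \<sqsubseteq>\<^bsub>P\<^esub> x}\<rparr>))"

definition nucleus :: "('a, 'm) gorder_scheme \<Rightarrow> ('a \<Rightarrow> 'a) \<Rightarrow> bool" where
  "nucleus P \<gamma> \<longleftrightarrow>
     \<gamma> \<in> carrier P \<rightarrow> carrier P \<and>
     Mono\<^bsub>P\<^esub> \<gamma> \<and>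
     (\<forall>x\<in>carrier P. x \<sqsubseteq>\<^bsub>P\<^esub> \<gamma> x) \<and>
     Idem\<^bsub>P\<^esub> \<gamma> \<and>
     (\<forall>x\<in>carrier P. \<forall>y\<in>carrier P. \<gamma> (x \<sqinter>\<^bsub>P\<^esub> y) = \<gamma> x \<sqinter>\<^bsub>P\<^esub> \<gamma> y)"

text \<open>
  Nuclei are taken to be extensional (\<open>undefined\<close> outside the carrier), so that each map on the
  carrier is represented by exactly one HOL function and the pointwise order is antisymmetric.
\<close>

definition Nuc :: "('a, 'm) gorder_scheme \<Rightarrow> ('a \<Rightarrow> 'a) gorder" where
  "Nuc P =
     \<lparr>carrier = {\<gamma> \<in> extensional (carrier P). nucleus P \<gamma>},
      eq = (=),
      le = (\<lambda>\<gamma> \<delta>. \<forall>x\<in>carrier P. \<gamma> x \<sqsubseteq>\<^bsub>P\<^esub> \<delta> x)\<rparr>"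

locale frame = complete_lattice +
  assumes meet_sup_distrib:
    "\<lbrakk>x \<in> carrier L; Y \<subseteq> carrier L\<rbrakk> \<Longrightarrow> x \<sqinter> \<Squnion>Y = \<Squnion>((\<lambda>y. x \<sqinter> y) ` Y)"

end

theory Submission
  imports Defs
begin

text \<open>
  The join \<open>\<gamma>\<close> of a set \<open>Y\<close> of nuclei sends \<open>x\<close> to the least common fixed point of \<open>Y\<close> above
  \<open>x\<close>: a maximal element above \<open>x\<close> among the lower bounds of the common fixed points above \<open>x\<close> is
  itself fixed by \<open>Y\<close>. To see that \<open>\<gamma> x \<sqinter> a \<sqsubseteq> b\<close>, choose a maximal \<open>m \<sqsupseteq> x\<close> in
  \<open>{y. y \<sqinter> a \<sqsubseteq> b \<and> y \<sqsubseteq> \<gamma> x}\<close>; if the elements of \<open>Y\<close> preserve the first condition above \<open>x\<close>,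
  then \<open>m\<close> is a common fixed point, hence \<open>m = \<gamma> x\<close>. With \<open>b\<close> fixed by \<open>Y\<close> this shows that \<open>\<gamma>\<close>
  preserves binary meets, and with \<open>a = \<alpha> x\<close> and \<open>b = \<beta> x\<close>, where \<open>\<beta>\<close> is the join of all
  \<open>\<alpha> \<sqinter> \<delta>\<close> with \<open>\<delta> \<in> Y\<close>, it gives the frame law.
\<close>

section \<open>Nuclei under the pointwise order\<close>

lemma nucleusI:
  assumes "weak_partial_order P"
    and "\<And>x. x \<in> carrier P \<Longrightarrow> \<gamma> x \<in> carrier P"
    and "\<And>x y. \<lbrakk>x \<in> carrier P; y \<in> carrier P; x \<sqsubseteq>\<^bsub>P\<^esub> y\<rbrakk> \<Longrightarrow> \<gamma> x \<sqsubseteq>\<^bsub>P\<^esub> \<gamma> y"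
    and "\<And>x. x \<in> carrier P \<Longrightarrow> x \<sqsubseteq>\<^bsub>P\<^esub> \<gamma> x"
    and "\<And>x. x \<in> carrier P \<Longrightarrow> \<gamma> (\<gamma> x) = \<gamma> x"
    and "\<And>x y. \<lbrakk>x \<in> carrier P; y \<in> carrier P\<rbrakk> \<Longrightarrow> \<gamma> (x \<sqinter>\<^bsub>P\<^esub> y) = \<gamma> x \<sqinter>\<^bsub>P\<^esub> \<gamma> y"
  shows "nucleus P \<gamma>"
proof -
  interpret weak_partial_order P by fact
  show ?thesis
    using assms unfolding nucleus_def isotone_def idempotent_def by auto
qed

lemma mem_Nuc_iff: "\<gamma> \<in> carrier (Nuc P) \<longleftrightarrow> \<gamma> \<in> extensional (carrier P) \<and> nucleus P \<gamma>"
  by (simp add: Nuc_def)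

lemma le_Nuc_iff: "\<gamma> \<sqsubseteq>\<^bsub>Nuc P\<^esub> \<delta> \<longleftrightarrow> (\<forall>x\<in>carrier P. \<gamma> x \<sqsubseteq>\<^bsub>P\<^esub> \<delta> x)"
  by (simp add: Nuc_def)

lemma (in partial_order) partial_order_Nuc: "partial_order (Nuc L)"
proof
  fix \<gamma> \<delta> assume *: "\<gamma> \<in> carrier (Nuc L)" "\<delta> \<in> carrier (Nuc L)"
    "\<gamma> \<sqsubseteq>\<^bsub>Nuc L\<^esub> \<delta>" "\<delta> \<sqsubseteq>\<^bsub>Nuc L\<^esub> \<gamma>"
  have "\<gamma> = \<delta>"
  proof (rule extensionalityI)
    show "\<gamma> \<in> extensional (carrier L)" "\<delta> \<in> extensional (carrier L)"
      using * by (auto simp: mem_Nuc_iff)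
    show "\<gamma> x = \<delta> x" if "x \<in> carrier L" for x
      using * that by (auto simp: mem_Nuc_iff le_Nuc_iff nucleus_def intro!: le_antisym)
  qed
  then show "\<gamma> .=\<^bsub>Nuc L\<^esub> \<delta>"
    by (simp add: Nuc_def)
next
  fix \<gamma> \<delta> \<epsilon>
  assume *: "\<gamma> \<in> carrier (Nuc L)" "\<delta> \<in> carrier (Nuc L)" "\<epsilon> \<in> carrier (Nuc L)"
    and le: "\<gamma> \<sqsubseteq>\<^bsub>Nuc L\<^esub> \<delta>" "\<delta> \<sqsubseteq>\<^bsub>Nuc L\<^esub> \<epsilon>"
  have "\<gamma> x \<in> carrier L \<and> \<delta> x \<in> carrier L \<and> \<epsilon> x \<in> carrier L" if "x \<in> carrier L" for x
    using * that by (auto simp: mem_Nuc_iff nucleus_def)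
  with le show "\<gamma> \<sqsubseteq>\<^bsub>Nuc L\<^esub> \<epsilon>"
    unfolding le_Nuc_iff by (meson le_trans)
qed (auto simp: Nuc_def nucleus_def)

section \<open>Common fixed points and the candidate for the join\<close>

definition common_fixpoints :: "('a, 'm) gorder_scheme \<Rightarrow> ('a \<Rightarrow> 'a) set \<Rightarrow> 'a set" where
  "common_fixpoints P Y = {c \<in> carrier P. \<forall>\<gamma>\<in>Y. \<gamma> c = c}"

text \<open>\<open>\<Sqinter>\<close> is a choice operator, so the value is meaningful only once the
  greatest lower bound is known to exist. Restricting to the carrier makes the map extensional, as
  \<open>Nuc\<close> demands.\<close>

definition nuc_sup :: "('a, 'm) gorder_scheme \<Rightarrow> ('a \<Rightarrow> 'a) set \<Rightarrow> 'a \<Rightarrow> 'a" where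
  "nuc_sup P Y = (\<lambda>x\<in>carrier P. \<Sqinter>\<^bsub>P\<^esub>{c \<in> common_fixpoints P Y. x \<sqsubseteq>\<^bsub>P\<^esub> c})"

text \<open>\<open>ceiling_implication\<close> stands in for Heyting implication: the
  \<open>y\<close> with \<open>y \<sqinter> a \<sqsubseteq> b\<close> need not have a greatest
  element, but among those below a given \<open>u\<close> each lies under a maximal one.\<close>

locale ceiling_semilattice = lower_semilattice +
  assumes default_enabled: "default_enabled L"
    and ceiling_implication: "\<lbrakk>a \<in> carrier L; b \<in> carrier L; u \<in> carrier L\<rbrakk> \<Longrightarrow>
      has_ceiling (L\<lparr>carrier := {y \<in> carrier L. y \<sqinter> a \<sqsubseteq> b \<and> y \<sqsubseteq> u}\<rparr>)"
begin

lemma meet_mono: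
  "\<lbrakk>x \<sqsubseteq> x'; y \<sqsubseteq> y'; x \<in> carrier L; x' \<in> carrier L; y \<in> carrier L; y' \<in> carrier L\<rbrakk>
    \<Longrightarrow> x \<sqinter> y \<sqsubseteq> x' \<sqinter> y'"
  by (meson le_trans meet_closed meet_le meet_left meet_right)

context
  fixes \<gamma> assumes \<gamma>: "\<gamma> \<in> carrier (Nuc L)"
begin

lemma nuc_closed [simp]: "x \<in> carrier L \<Longrightarrow> \<gamma> x \<in> carrier L"
  and nuc_mono: "\<lbrakk>x \<in> carrier L; y \<in> carrier L; x \<sqsubseteq> y\<rbrakk> \<Longrightarrow> \<gamma> x \<sqsubseteq> \<gamma> y"
  and nuc_ascending: "x \<in> carrier L \<Longrightarrow> x \<sqsubseteq> \<gamma> x"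
  and nuc_idem: "x \<in> carrier L \<Longrightarrow> \<gamma> (\<gamma> x) = \<gamma> x"
  and nuc_meet: "\<lbrakk>x \<in> carrier L; y \<in> carrier L\<rbrakk> \<Longrightarrow> \<gamma> (x \<sqinter> y) = \<gamma> x \<sqinter> \<gamma> y"
  using \<gamma> by (auto simp: mem_Nuc_iff nucleus_def isotone_def idempotent_def eq_is_equal)

lemma nuc_meet_le:
  "\<lbrakk>x \<in> carrier L; a \<in> carrier L\<rbrakk> \<Longrightarrow> \<gamma> x \<sqinter> a \<sqsubseteq> \<gamma> (x \<sqinter> a)"
  by (simp add: nuc_meet meet_mono nuc_ascending)

end

section \<open>Joins of nuclei\<close>

context
  fixes Y assumes Y: "Y \<subseteq> carrier (Nuc L)"
begin

lemma ex_least_common_fixpoint: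
  assumes x: "x \<in> carrier L"
  shows "\<exists>m. least L m {c \<in> common_fixpoints L Y. x \<sqsubseteq> c}"
proof -
  let ?F = "{c \<in> common_fixpoints L Y. x \<sqsubseteq> c}"
  have F: "?F \<subseteq> carrier L"
    by (auto simp: common_fixpoints_def)
  \<comment> \<open>\<open>?F\<close> could be empty at this stage, and its lower bounds are then
    the whole carrier; the \<open>m\<close> obtained from the ceiling turns out to lie in
    \<open>?F\<close>, which excludes this.\<close>
  have "has_ceiling (L\<lparr>carrier := Lower L ?F\<rparr>)"
    using default_enabled F by (simp add: default_enabled_def)
  moreover have "x \<in> Lower L ?F"
    using x by (auto simp: Lower_def)
  ultimately obtain m where m: "m \<in> Lower L ?F" "x \<sqsubseteq> m"
    and max: "\<And>y. \<lbrakk>y \<in> Lower L ?F; m \<sqsubseteq> y\<rbrakk> \<Longrightarrow> y = m"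
    unfolding has_ceiling_def maximal_def by auto
  have mc: "m \<in> carrier L"
    using m by (auto simp: Lower_def)
  have "\<gamma> m = m" if \<gamma>: "\<gamma> \<in> Y" for \<gamma>
  proof (rule max)
    have \<gamma>': "\<gamma> \<in> carrier (Nuc L)"
      using \<gamma> Y by auto
    show "m \<sqsubseteq> \<gamma> m"
      using nuc_ascending[OF \<gamma>' mc] .
    \<comment> \<open>Each \<open>c\<close> in \<open>?F\<close> is fixed by
      \<open>\<gamma>\<close>, so \<open>m \<sqsubseteq> c\<close> yields
      \<open>\<gamma> m \<sqsubseteq> \<gamma> c = c\<close>.\<close>
    show "\<gamma> m \<in> Lower L ?F"
    proof (rule Lower_memI)
      fix c assume c: "c \<in> ?F"
      then have "m \<sqsubseteq> c" "c \<in> carrier L" "\<gamma> c = c"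
        using m F \<gamma> by (auto simp: common_fixpoints_def)
      then show "\<gamma> m \<sqsubseteq> c"
        using nuc_mono[OF \<gamma>' mc] by metis
    qed (simp add: \<gamma>' mc)
  qed
  with m mc F have "least L m ?F"
    by (auto simp: least_def common_fixpoints_def)
  then show ?thesis ..
qed

text \<open>A least element of a set is also its greatest lower bound, and by antisymmetry that
  bound is unique, so the choice inside \<open>\<Sqinter>\<close> can return nothing else. The next
  four lemmas are read off from this.\<close>

lemma least_nuc_sup:
  assumes x: "x \<in> carrier L"
  shows "least L (nuc_sup L Y x) {c \<in> common_fixpoints L Y. x \<sqsubseteq> c}"
    (is "least L _ ?F")
proof -
  obtain m where m: "least L m ?F"
    using ex_least_common_fixpoint[OF x] ..
  then have glb: "greatest L m (Lower L ?F)"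
    unfolding least_def greatest_def by (auto simp: Lower_def)
  have "\<Sqinter>?F = m"
    unfolding inf_def by (rule some_equality, fact glb) (rule greatest_unique[OF _ glb])
  with m x show ?thesis
    by (simp add: nuc_sup_def)
qed

lemma nuc_sup_closed [simp]: "x \<in> carrier L \<Longrightarrow> nuc_sup L Y x \<in> carrier L"
  using least_nuc_sup by auto

lemma nuc_sup_ascending: "x \<in> carrier L \<Longrightarrow> x \<sqsubseteq> nuc_sup L Y x"
  using least_nuc_sup by (auto simp: least_def)

lemma nuc_sup_fixed: "\<lbrakk>x \<in> carrier L; \<gamma> \<in> Y\<rbrakk> \<Longrightarrow> \<gamma> (nuc_sup L Y x) = nuc_sup L Y x"
  using least_nuc_sup by (auto simp: least_def common_fixpoints_def)

lemma nuc_sup_le: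
  "\<lbrakk>x \<in> carrier L; c \<in> carrier L; x \<sqsubseteq> c; \<And>\<gamma>. \<gamma> \<in> Y \<Longrightarrow> \<gamma> c = c\<rbrakk> \<Longrightarrow> nuc_sup L Y x \<sqsubseteq> c"
  using least_nuc_sup by (auto simp: least_def common_fixpoints_def)

text \<open>An induction principle for the least common fixed point, with a maximal element in place
  of transfinite iteration.\<close>

lemma nuc_sup_meet_le:
  assumes carr: "x \<in> carrier L" "a \<in> carrier L" "b \<in> carrier L"
    and x: "x \<sqinter> a \<sqsubseteq> b"
    and step: "\<And>\<gamma> y. \<lbrakk>\<gamma> \<in> Y; y \<in> carrier L; x \<sqsubseteq> y; y \<sqinter> a \<sqsubseteq> b\<rbrakk> \<Longrightarrow> \<gamma> y \<sqinter> a \<sqsubseteq> b"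
  shows "nuc_sup L Y x \<sqinter> a \<sqsubseteq> b"
proof -
  let ?s = "nuc_sup L Y x"
  have s: "?s \<in> carrier L"
    using carr by simp
  \<comment> \<open>Taking \<open>u\<close> to be \<open>?s\<close> puts \<open>m\<close> below the
    join. Members of \<open>Y\<close> fix \<open>?s\<close>, so they map elements below it to
    elements below it, and maximality applies to \<open>\<gamma> m\<close>.\<close>
  obtain m where m: "m \<in> carrier L" "m \<sqinter> a \<sqsubseteq> b" "m \<sqsubseteq> ?s" "x \<sqsubseteq> m"
    and max: "\<And>y. \<lbrakk>y \<in> carrier L; y \<sqinter> a \<sqsubseteq> b; y \<sqsubseteq> ?s; m \<sqsubseteq> y\<rbrakk> \<Longrightarrow> y = m"
    using ceiling_implication[OF carr(2,3) s] x carr(1) nuc_sup_ascending[OF carr(1)]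
    unfolding has_ceiling_def maximal_def by auto
  have "\<gamma> m = m" if \<gamma>: "\<gamma> \<in> Y" for \<gamma>
  proof (rule max)
    have \<gamma>': "\<gamma> \<in> carrier (Nuc L)"
      using \<gamma> Y by auto
    show "\<gamma> m \<in> carrier L" "m \<sqsubseteq> \<gamma> m"
      using \<gamma>' m by (auto intro: nuc_ascending)
    show "\<gamma> m \<sqinter> a \<sqsubseteq> b"
      using step[OF \<gamma>] m by simp
    show "\<gamma> m \<sqsubseteq> ?s"
      using nuc_mono[OF \<gamma>' m(1) s m(3)] nuc_sup_fixed[OF carr(1) \<gamma>] by simp
  qed
  then have "?s \<sqsubseteq> m"
    using nuc_sup_le carr m by simp
  with m s have "?s = m"
    by (simp add: le_antisym)
  with m show ?thesis
    by simp
qed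

text \<open>Preservation of meets is the hard clause. \<open>heyting\<close> raises one argument of
  a meet while the other is held fixed, staying below a target fixed by \<open>Y\<close>.\<close>

lemma nuc_sup_in_Nuc: "nuc_sup L Y \<in> carrier (Nuc L)"
proof -
  let ?s = "nuc_sup L Y"
  have mono: "?s x \<sqsubseteq> ?s y" if "x \<in> carrier L" "y \<in> carrier L" "x \<sqsubseteq> y" for x y
    using that by (intro nuc_sup_le) (auto simp: nuc_sup_fixed intro: le_trans nuc_sup_ascending)
  have heyting: "?s x \<sqinter> a \<sqsubseteq> c"
    if "x \<in> carrier L" "a \<in> carrier L" "c \<in> carrier L" "x \<sqinter> a \<sqsubseteq> c" "\<And>\<gamma>. \<gamma> \<in> Y \<Longrightarrow> \<gamma> c = c"
    for x a c
  proof (rule nuc_sup_meet_le)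
    fix \<gamma> y assume \<gamma>: "\<gamma> \<in> Y" and y: "y \<in> carrier L" "y \<sqinter> a \<sqsubseteq> c"
    have \<gamma>': "\<gamma> \<in> carrier (Nuc L)"
      using \<gamma> Y by auto
    have "\<gamma> y \<sqinter> a \<sqsubseteq> \<gamma> (y \<sqinter> a)"
      using \<gamma>' y that by (simp add: nuc_meet_le)
    moreover have "\<gamma> (y \<sqinter> a) \<sqsubseteq> c"
      using nuc_mono[OF \<gamma>' _ _ y(2)] y that(2,3) that(5)[OF \<gamma>] by simp
    ultimately show "\<gamma> y \<sqinter> a \<sqsubseteq> c"
      using le_trans \<gamma>' y that by (meson meet_closed nuc_closed)
  qed (use that in auto)
  have "nucleus L ?s"
  proof (rule nucleusI)
    show "?s (?s x) = ?s x" if "x \<in> carrier L" for x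
      using that nuc_sup_le[of "?s x" "?s x"]
      by (simp add: le_antisym nuc_sup_fixed nuc_sup_ascending)
    fix x y assume xy: "x \<in> carrier L" "y \<in> carrier L"
    \<comment> \<open>Raise \<open>y\<close> to \<open>?s y\<close> first, then \<open>x\<close> to
      \<open>?s x\<close> against the already raised \<open>?s y\<close>; the target is
      \<open>?s (x \<sqinter> y)\<close> both times.\<close>
    have "x \<sqinter> ?s y \<sqsubseteq> ?s (x \<sqinter> y)"
      using heyting[of y x "?s (x \<sqinter> y)"] xy
      by (simp add: meet_comm[of L _ x] nuc_sup_ascending nuc_sup_fixed)
    then have "?s x \<sqinter> ?s y \<sqsubseteq> ?s (x \<sqinter> y)"
      using heyting[of x "?s y" "?s (x \<sqinter> y)"] xy by (simp add: nuc_sup_fixed)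
    then show "?s (x \<sqinter> y) = ?s x \<sqinter> ?s y"
      using xy by (intro le_antisym meet_le mono) (auto intro: meet_left meet_right)
  qed (auto intro: mono nuc_sup_ascending weak_partial_order_axioms)
  then show ?thesis
    by (simp add: mem_Nuc_iff nuc_sup_def)
qed

text \<open>Each \<open>\<gamma>\<close> in \<open>Y\<close> lies below the join because
  \<open>\<gamma> x\<close> is below \<open>\<gamma>\<close> of the fixed point above
  \<open>x\<close>. For an upper bound \<open>\<delta>\<close>, every \<open>\<delta> x\<close> is a
  common fixed point, since \<open>\<gamma> (\<delta> x) \<sqsubseteq> \<delta> (\<delta> x) =
  \<delta> x\<close>.\<close>

lemma is_lub_nuc_sup: "is_lub (Nuc L) (nuc_sup L Y) Y"
proof (rule least_UpperI)
  fix \<gamma> assume \<gamma>: "\<gamma> \<in> Y"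
  then have "\<gamma> \<in> carrier (Nuc L)"
    using Y by auto
  then show "\<gamma> \<sqsubseteq>\<^bsub>Nuc L\<^esub> nuc_sup L Y"
    using nuc_mono[of \<gamma>] nuc_sup_ascending nuc_sup_fixed[OF _ \<gamma>]
    by (metis le_Nuc_iff nuc_sup_closed)
next
  fix \<delta> assume \<delta>: "\<delta> \<in> Upper (Nuc L) Y"
  then have \<delta>': "\<delta> \<in> carrier (Nuc L)"
    by (auto simp: Upper_def)
  show "nuc_sup L Y \<sqsubseteq>\<^bsub>Nuc L\<^esub> \<delta>"
    unfolding le_Nuc_iff
  proof (intro ballI nuc_sup_le)
    fix x \<gamma> assume x: "x \<in> carrier L" and \<gamma>: "\<gamma> \<in> Y"
    then have \<gamma>': "\<gamma> \<in> carrier (Nuc L)"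
      using Y by auto
    have "\<gamma> (\<delta> x) \<sqsubseteq> \<delta> (\<delta> x)"
      using \<delta> Y \<gamma> x \<delta>' by (auto simp: Upper_def le_Nuc_iff)
    then show "\<gamma> (\<delta> x) = \<delta> x"
      using \<gamma>' \<delta>' x by (intro le_antisym) (auto simp: nuc_idem nuc_ascending)
  qed (auto simp: \<delta>' nuc_ascending)
qed (use Y nuc_sup_in_Nuc in auto)

end

lemma complete_lattice_Nuc: "complete_lattice (Nuc L)"
proof -
  interpret N: partial_order "Nuc L"
    by (rule partial_order_Nuc)
  show ?thesis
  proof (rule N.complete_latticeI)
    fix Y assume Y: "Y \<subseteq> carrier (Nuc L)"
    show "\<exists>s. is_lub (Nuc L) s Y"
      using is_lub_nuc_sup[OF Y] by blast
    \<comment> \<open>The infimum of \<open>Y\<close> is the supremum of its lower bounds.\<close>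
    have "is_lub (Nuc L) (nuc_sup L (Lower (Nuc L) Y)) (Lower (Nuc L) Y)"
      by (rule is_lub_nuc_sup) simp
    then have "is_glb (Nuc L) (nuc_sup L (Lower (Nuc L) Y)) Y"
      using Y by (auto simp: least_def greatest_def Upper_def Lower_def)
    then show "\<exists>i. is_glb (Nuc L) i Y" by blast
  qed
qed

section \<open>Binary meets of nuclei\<close>

lemma pointwise_meet_in_Nuc:
  assumes \<gamma>: "\<gamma> \<in> carrier (Nuc L)" and \<delta>: "\<delta> \<in> carrier (Nuc L)"
  shows "(\<lambda>x\<in>carrier L. \<gamma> x \<sqinter> \<delta> x) \<in> carrier (Nuc L)"
proof -
  have "nucleus L (\<lambda>x\<in>carrier L. \<gamma> x \<sqinter> \<delta> x)"
  proof (rule nucleusI)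
    fix x assume x: "x \<in> carrier L"
    \<comment> \<open>Idempotence: monotonicity bounds the two factors by
      \<open>\<gamma> (\<gamma> x) = \<gamma> x\<close> and
      \<open>\<delta> (\<delta> x) = \<delta> x\<close>.\<close>
    have "\<gamma> (\<gamma> x \<sqinter> \<delta> x) \<sqinter> \<delta> (\<gamma> x \<sqinter> \<delta> x) \<sqsubseteq> \<gamma> x \<sqinter> \<delta> x"
      using nuc_mono[OF \<gamma>, of "\<gamma> x \<sqinter> \<delta> x" "\<gamma> x"] nuc_mono[OF \<delta>, of "\<gamma> x \<sqinter> \<delta> x" "\<delta> x"] \<gamma> \<delta> x
      by (intro meet_mono) (auto simp: nuc_idem meet_left meet_right)
    then show "(\<lambda>x\<in>carrier L. \<gamma> x \<sqinter> \<delta> x) ((\<lambda>x\<in>carrier L. \<gamma> x \<sqinter> \<delta> x) x)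
        = (\<lambda>x\<in>carrier L. \<gamma> x \<sqinter> \<delta> x) x"
      using x \<gamma> \<delta> by (simp add: le_antisym meet_le nuc_ascending)
  next
    fix x y assume xy: "x \<in> carrier L" "y \<in> carrier L"
    then have "(\<gamma> x \<sqinter> \<gamma> y) \<sqinter> (\<delta> x \<sqinter> \<delta> y) = (\<gamma> x \<sqinter> \<delta> x) \<sqinter> (\<gamma> y \<sqinter> \<delta> y)"
      using \<gamma> \<delta> by (smt (verit) meet_assoc meet_comm meet_closed nuc_closed)
    then show "(\<lambda>x\<in>carrier L. \<gamma> x \<sqinter> \<delta> x) (x \<sqinter> y)
        = (\<lambda>x\<in>carrier L. \<gamma> x \<sqinter> \<delta> x) x \<sqinter> (\<lambda>x\<in>carrier L. \<gamma> x \<sqinter> \<delta> x) y"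
      using xy \<gamma> \<delta> by (simp add: nuc_meet)
  qed (use \<gamma> \<delta> in \<open>auto intro: meet_le meet_mono nuc_ascending nuc_mono weak_partial_order_axioms\<close>)
  then show ?thesis
    by (simp add: mem_Nuc_iff)
qed

text \<open>Lets the frame law be checked at each point of the carrier.\<close>

lemma meet_Nuc:
  assumes \<gamma>: "\<gamma> \<in> carrier (Nuc L)" and \<delta>: "\<delta> \<in> carrier (Nuc L)"
  shows "\<gamma> \<sqinter>\<^bsub>Nuc L\<^esub> \<delta> = (\<lambda>x\<in>carrier L. \<gamma> x \<sqinter> \<delta> x)"
proof -
  interpret N: complete_lattice "Nuc L"
    by (rule complete_lattice_Nuc)
  have *: "(\<lambda>x\<in>carrier L. \<gamma> x \<sqinter> \<delta> x) \<in> carrier (Nuc L)"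
    using assms by (rule pointwise_meet_in_Nuc)
  show ?thesis
  proof (rule N.le_antisym)
    show "(\<lambda>x\<in>carrier L. \<gamma> x \<sqinter> \<delta> x) \<sqsubseteq>\<^bsub>Nuc L\<^esub> \<gamma> \<sqinter>\<^bsub>Nuc L\<^esub> \<delta>"
      using * \<gamma> \<delta> by (intro N.meet_le) (auto simp: le_Nuc_iff meet_left meet_right)
    show "\<gamma> \<sqinter>\<^bsub>Nuc L\<^esub> \<delta> \<sqsubseteq>\<^bsub>Nuc L\<^esub> (\<lambda>x\<in>carrier L. \<gamma> x \<sqinter> \<delta> x)"
      using N.meet_left[OF assms] N.meet_right[OF assms] N.meet_closed[OF assms] \<gamma> \<delta>
      by (auto simp: le_Nuc_iff intro!: meet_le)
  qed (use * \<gamma> \<delta> in auto)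
qed

section \<open>The frame law\<close>

lemma frame_Nuc: "frame (Nuc L)"
proof -
  interpret N: complete_lattice "Nuc L"
    by (rule complete_lattice_Nuc)
  show ?thesis
  proof
    fix \<alpha> Y assume \<alpha>: "\<alpha> \<in> carrier (Nuc L)" and Y: "Y \<subseteq> carrier (Nuc L)"
    let ?Z = "(\<lambda>\<delta>. \<alpha> \<sqinter>\<^bsub>Nuc L\<^esub> \<delta>) ` Y"
    let ?\<beta> = "\<Squnion>\<^bsub>Nuc L\<^esub>?Z"
    have Z: "?Z \<subseteq> carrier (Nuc L)"
      using \<alpha> Y by auto
    then have \<beta>: "?\<beta> \<in> carrier (Nuc L)"
      by simp
    have sup: "\<Squnion>\<^bsub>Nuc L\<^esub>Y = nuc_sup L Y"
      unfolding sup_def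
      by (rule some_equality, rule is_lub_nuc_sup[OF Y])
        (rule N.least_unique[OF _ is_lub_nuc_sup[OF Y]])
    have \<alpha>\<delta>: "\<alpha> y \<sqinter> \<delta> y \<sqsubseteq> ?\<beta> y" if "\<delta> \<in> Y" "y \<in> carrier L" for \<delta> y
    proof -
      have "\<alpha> \<sqinter>\<^bsub>Nuc L\<^esub> \<delta> \<sqsubseteq>\<^bsub>Nuc L\<^esub> ?\<beta>"
        using that by (intro N.sup_upper[OF Z]) auto
      moreover have "\<delta> \<in> carrier (Nuc L)"
        using that Y by auto
      ultimately show ?thesis
        using \<alpha> that unfolding le_Nuc_iff by (auto simp: meet_Nuc)
    qed
    \<comment> \<open>The induction needs constant \<open>a\<close> and \<open>b\<close>, so
      \<open>\<alpha>\<close> and \<open>?\<beta>\<close> are frozen at \<open>x\<close> while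
      \<open>y\<close> moves upwards.\<close>
    have \<alpha>\<beta>: "nuc_sup L Y x \<sqinter> \<alpha> x \<sqsubseteq> ?\<beta> x" if x: "x \<in> carrier L" for x
    proof (rule nuc_sup_meet_le[OF Y])
      show "x \<sqinter> \<alpha> x \<sqsubseteq> ?\<beta> x"
        using x \<alpha> \<beta> le_trans[OF meet_left nuc_ascending] by simp
      fix \<delta> y assume \<delta>: "\<delta> \<in> Y" and y: "y \<in> carrier L" "x \<sqsubseteq> y" "y \<sqinter> \<alpha> x \<sqsubseteq> ?\<beta> x"
      have \<delta>': "\<delta> \<in> carrier (Nuc L)"
        using \<delta> Y by auto
      have carr: "\<delta> y \<in> carrier L" "\<alpha> x \<in> carrier L" "\<alpha> y \<in> carrier L"
          "?\<beta> y \<in> carrier L" "?\<beta> x \<in> carrier L"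
        using \<alpha> \<beta> \<delta>' x y by auto
      \<comment> \<open>\<open>\<alpha> x \<sqsubseteq> \<alpha> y\<close> comes from
        \<open>x \<sqsubseteq> y\<close>, the premise that \<open>step\<close> of
        \<open>nuc_sup_meet_le\<close> carries along.\<close>
      have "\<delta> y \<sqinter> \<alpha> x \<sqsubseteq> \<alpha> y \<sqinter> \<delta> y"
        using meet_mono[OF nuc_mono[OF \<alpha> x y(1,2)] le_refl] carr by (simp add: meet_comm[of L "\<delta> y"])
      then have "\<delta> y \<sqinter> \<alpha> x \<sqsubseteq> ?\<beta> y"
        using \<alpha>\<delta>[OF \<delta> y(1)] carr by (meson le_trans meet_closed)
      \<comment> \<open>Keeping the factor \<open>\<alpha> x\<close> returns the bound from
        \<open>y\<close> to \<open>x\<close>: it moves inside \<open>?\<beta>\<close>, where the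
        induction hypothesis bounds \<open>y \<sqinter> \<alpha> x\<close> by
        \<open>?\<beta> x\<close>.\<close>
      then have "\<delta> y \<sqinter> \<alpha> x \<sqsubseteq> ?\<beta> y \<sqinter> \<alpha> x"
        using carr by (intro meet_le) (auto intro: meet_right)
      also have "?\<beta> y \<sqinter> \<alpha> x \<sqsubseteq> ?\<beta> (y \<sqinter> \<alpha> x)"
        using nuc_meet_le[OF \<beta>] y carr by simp
      also have "?\<beta> (y \<sqinter> \<alpha> x) \<sqsubseteq> ?\<beta> (?\<beta> x)"
        using nuc_mono[OF \<beta> _ _ y(3)] y carr by simp
      also have "?\<beta> (?\<beta> x) = ?\<beta> x"
        using \<beta> x by (rule nuc_idem)
      finally show "\<delta> y \<sqinter> \<alpha> x \<sqsubseteq> ?\<beta> x"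
        using carr \<beta> y by simp
    qed (use x \<alpha> \<beta> in auto)
    have S: "\<Squnion>\<^bsub>Nuc L\<^esub>Y \<in> carrier (Nuc L)"
      using Y by simp
    show "\<alpha> \<sqinter>\<^bsub>Nuc L\<^esub> \<Squnion>\<^bsub>Nuc L\<^esub>Y = ?\<beta>"
    proof (rule N.le_antisym)
      show "\<alpha> \<sqinter>\<^bsub>Nuc L\<^esub> \<Squnion>\<^bsub>Nuc L\<^esub>Y \<sqsubseteq>\<^bsub>Nuc L\<^esub> ?\<beta>"
        using \<alpha>\<beta> \<alpha> S by (simp add: le_Nuc_iff meet_Nuc sup meet_comm[of L "\<alpha> _"])
      \<comment> \<open>This direction holds in every complete lattice, by monotonicity of the
        meet.\<close>
      show "?\<beta> \<sqsubseteq>\<^bsub>Nuc L\<^esub> \<alpha> \<sqinter>\<^bsub>Nuc L\<^esub> \<Squnion>\<^bsub>Nuc L\<^esub>Y"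
      proof (rule N.sup_least[OF Z])
        fix \<zeta> assume "\<zeta> \<in> ?Z"
        then obtain \<delta> where \<delta>: "\<delta> \<in> Y" "\<zeta> = \<alpha> \<sqinter>\<^bsub>Nuc L\<^esub> \<delta>"
          by auto
        then have \<delta>': "\<delta> \<in> carrier (Nuc L)" "\<delta> \<sqsubseteq>\<^bsub>Nuc L\<^esub> \<Squnion>\<^bsub>Nuc L\<^esub>Y"
          using Y N.sup_upper by auto
        then show "\<zeta> \<sqsubseteq>\<^bsub>Nuc L\<^esub> \<alpha> \<sqinter>\<^bsub>Nuc L\<^esub> \<Squnion>\<^bsub>Nuc L\<^esub>Y"
          using \<alpha> S \<delta> by (auto simp: meet_Nuc le_Nuc_iff intro!: meet_mono)
      qed (use \<alpha> S in simp)
    qed (use \<alpha> \<beta> S in auto)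
  qed
qed

end

theorem theorem8p9:
  fixes P :: "('a, 'm) gorder_scheme"
  assumes "lower_semilattice P"
    and "default_enabled P"
    and "\<And>a b. a \<in> carrier P \<Longrightarrow> b \<in> carrier P \<Longrightarrow>
           default_enabled_within P {x \<in> carrier P. x \<sqinter>\<^bsub>P\<^esub> a \<sqsubseteq>\<^bsub>P\<^esub> b}"
  shows "frame (Nuc P)"
proof -
  interpret lower_semilattice P by fact
  interpret ceiling_semilattice P
  proof
    \<comment> \<open>The ceiling for \<open>u\<close> is the second condition of
      \<open>default_enabled_within\<close>, taken at the implication set of \<open>a\<close> and
      \<open>b\<close>.\<close>
    fix a b u assume "a \<in> carrier P" "b \<in> carrier P" "u \<in> carrier P"
    then show "has_ceiling (P\<lparr>carrier := {y \<in> carrier P. y \<sqinter>\<^bsub>P\<^esub> a \<sqsubseteq>\<^bsub>P\<^esub> b \<and> y \<sqsubseteq>\<^bsub>P\<^esub> u}\<rparr>)"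
      using assms(3)[of a b] by (simp add: default_enabled_within_def)
  qed fact
  show ?thesis
    by (rule frame_Nuc)
qed

end
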